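(* Let $\Bbbk$ be a field, $0\ne v\in\Bbbk$, and suppose $[n]!\neq0$ in $\Bbbk$. For every $p\in\mathcal P(n)$ the vector $\mu(p)\in V^{\otimes n}$ is maximal. Moreover the vectors $\mu(p)$, $p\in\mathcal P(n)$, are non-isotropic and pairwise orthogonal with respect to $\langle-,-\rangle$, hence linearly independent.
   Context: Quantum integers: for $k\ge0$, $[k]=\sum_{t=0}^{k-1}v^{k-1-2t}\in\Bbbk$, $[-k]=-[k]$, $[k]!=[1][2]\cdots[k]$, $[0]!=1$. $V$ is the two-dimensional space with basis $y_1,y_{-1}$ and operators $Ey_1=0$, $Ey_{-1}=y_1$, $Fy_1=y_{-1}$, $Fy_{-1}=0$, $Ky_{\pm1}=v^{\pm1}y_{\pm1}$. On $V^{\otimes n}$, $E$ acts as $\sum_{j=1}^nK^{\otimes(j-1)}\otimes E\otimes1^{\otimes(n-j)}$ and $F$ acts as $\sum_{j=1}^n1^{\otimes(j-1)}\otimes F\otimes(K^{-1})^{\otimes(n-j)}$; the vector $y_{i_1,\dots,i_n}=y_{i_1}\otimes\cdots\otimes y_{i_n}$ ($i_j\in\{\pm1\}$) has weight $\sum_ji_j$. ($V^{\otimes0}=\Bbbk$, of weight $0$, with $E=F=0$.) A vector is maximal if it is nonzero and killed by $E$. $\langle-,-\rangle$ is the symmetric bilinear form on $V^{\otimes n}$ for which the $y_{i_1,\dots,i_n}$ are orthonormal; a vector $b$ is non-isotropic if $\langle b,b\rangle\ne0$. $\mathcal P(n)$ is the set of length $n$ walks on the Bratteli diagram: sequences of partitions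 with at most two parts, starting from the empty partition, each obtained from the previous one by adding one box, either to the first row (vertical edge) or to the second row (diagonal edge). For $b\in V^{\otimes(m-1)}$ of weight $i_b$, put $\Phi_1(b)=b\otimes y_1$ and $\Phi_2(b)=[i_b]\,b\otimes y_{-1}-v^{i_b}Fb\otimes y_1$ in $V^{\otimes m}$. For $p\in\mathcal P(n)$, $\mu(p)=\Upsilon_n\cdots\Upsilon_1(1)$, where $\Upsilon_i=\Phi_1$ (resp. $\Phi_2$) if the $i$th edge of $p$ is vertical (resp. diagonal). *)

theory Defs
  imports Complex_Main "HOL-Library.Function_Algebras"
begin

text \<open>
  The field is an arbitrary type of class \<^class>\<open>field\<close>; the parameter \<open>v\<close> is passed
  explicitly throughout.
\<close>

definition qint :: "'a::field \<Rightarrow> int \<Rightarrow> 'a" where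
  "qint v k = (if k \<ge> 0 then (\<Sum>t<nat k. v powi (k - 1 - 2 * int t))
               else - (\<Sum>t<nat (- k). v powi (- k - 1 - 2 * int t)))"

definition qfact :: "'a::field \<Rightarrow> nat \<Rightarrow> 'a" where
  "qfact v n = (\<Prod>k=1..n. qint v (int k))"

text \<open>
  \<open>Pos\<close> and \<open>Neg\<close> are the indices \<open>1\<close> and \<open>-1\<close> of the basis of \<open>V\<close>, so \<open>V\<close> is the space of
  all functions on this two-element type. An operator on \<open>V\<close> is given by the
  images of the basis vectors: \<open>A i\<close> is the vector \<open>A y\<^sub>i\<close>, and \<open>A i j\<close> its coefficient at \<open>y\<^sub>j\<close>.
\<close>

datatype ind = Pos | Neg

primrec ind_val :: "ind \<Rightarrow> int" where
  "ind_val Pos = 1"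
| "ind_val Neg = - 1"

type_synonym 'a vec1 = "ind \<Rightarrow> 'a"
type_synonym 'a op1 = "ind \<Rightarrow> 'a vec1"

definition y1 :: "ind \<Rightarrow> 'a::field vec1" where
  "y1 i = (\<lambda>j. if j = i then 1 else 0)"

primrec E1 :: "'a::field op1" where
  "E1 Pos = 0"
| "E1 Neg = y1 Pos"

primrec F1 :: "'a::field op1" where
  "F1 Pos = y1 Neg"
| "F1 Neg = 0"

definition K1 :: "'a::field \<Rightarrow> 'a op1" where
  "K1 v i = (\<lambda>j. v powi ind_val i * y1 i j)"

definition Kinv1 :: "'a::field \<Rightarrow> 'a op1" where
  "Kinv1 v i = (\<lambda>j. v powi (- ind_val i) * y1 i j)"

definition id1 :: "'a::field op1" where
  "id1 i = y1 i"

text \<open>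
  The \<open>n\<close>-th tensor power of \<open>V\<close> consists of the functions on index lists that vanish off the
  lists of length \<open>n\<close>; \<open>x [i\<^sub>1, \<dots>, i\<^sub>n]\<close> is the coefficient of \<open>x\<close> at the tensor product
  of \<open>y\<^sub>i\<close> for \<open>i = i\<^sub>1, \<dots>, i\<^sub>n\<close>.
\<close>

type_synonym 'a tvec = "ind list \<Rightarrow> 'a"

definition tensor_power :: "nat \<Rightarrow> 'a::field tvec set" where
  "tensor_power n = {x. \<forall>s. length s \<noteq> n \<longrightarrow> x s = 0}"

definition tscale :: "'a::field \<Rightarrow> 'a tvec \<Rightarrow> 'a tvec" where
  "tscale c x = (\<lambda>s. c * x s)"

lemma vector_space_tscale: "vector_space (tscale :: 'a::field \<Rightarrow> 'a tvec \<Rightarrow> 'a tvec)"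
  by unfold_locales (auto simp: tscale_def fun_eq_iff algebra_simps)

definition tone :: "'a::field tvec" where
  "tone = (\<lambda>s. if s = [] then 1 else 0)"

definition tsnoc :: "'a::field tvec \<Rightarrow> 'a vec1 \<Rightarrow> 'a tvec"  (infixl "\<otimes>\<^sub>V" 75) where
  "b \<otimes>\<^sub>V u = (\<lambda>s. if s = [] then 0 else b (butlast s) * u (last s))"

text \<open>The tensor product of a list of operators on \<open>V\<close>, acting on the tensor power of \<open>V\<close>.\<close>

definition tensor_op :: "'a::field op1 list \<Rightarrow> 'a tvec \<Rightarrow> 'a tvec" where
  "tensor_op As x = (\<lambda>s. if length s = length As
     then \<Sum>t | length t = length As. x t * (\<Prod>j<length As. (As ! j) (t ! j) (s ! j))
     else 0)"

definition E_act :: "'a::field \<Rightarrow> nat \<Rightarrow> 'a tvec \<Rightarrow> 'a tvec" where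
  "E_act v n x = (\<Sum>j=1..n. tensor_op (replicate (j - 1) (K1 v) @ [E1] @ replicate (n - j) id1) x)"

definition F_act :: "'a::field \<Rightarrow> nat \<Rightarrow> 'a tvec \<Rightarrow> 'a tvec" where
  "F_act v n x = (\<Sum>j=1..n. tensor_op (replicate (j - 1) id1 @ [F1] @ replicate (n - j) (Kinv1 v)) x)"

definition has_weight :: "int \<Rightarrow> 'a::field tvec \<Rightarrow> bool" where
  "has_weight i x \<longleftrightarrow> (\<forall>s. x s \<noteq> 0 \<longrightarrow> (\<Sum>k\<leftarrow>s. ind_val k) = i)"

text \<open>
  A nonzero vector has at most one weight. The zero vector has every weight, so its value here is
  unspecified; this is harmless in \<open>Phi2\<close>, which maps \<open>0\<close> to \<open>0\<close> whatever the weight.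
\<close>

definition weight_of :: "'a::field tvec \<Rightarrow> int" where
  "weight_of x = (THE i. has_weight i x)"

definition maximal :: "'a::field \<Rightarrow> nat \<Rightarrow> 'a tvec \<Rightarrow> bool" where
  "maximal v n x \<longleftrightarrow> x \<in> tensor_power n \<and> x \<noteq> 0 \<and> E_act v n x = 0"

definition form :: "nat \<Rightarrow> 'a::field tvec \<Rightarrow> 'a tvec \<Rightarrow> 'a" where
  "form n x y = (\<Sum>s | length s = n. x s * y s)"

definition non_isotropic :: "nat \<Rightarrow> 'a::field tvec \<Rightarrow> bool" where
  "non_isotropic n x \<longleftrightarrow> form n x x \<noteq> 0"

text \<open>
  A partition with at most two parts is a pair \<open>(a, b)\<close> with \<open>b \<le> a\<close>. A walk of length \<open>n\<close> is the
  list of its \<open>n + 1\<close> vertices; its \<open>i\<close>-th edge, \<open>1 \<le> i \<le> n\<close>, joins the vertices \<open>p ! (i - 1)\<close>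
  and \<open>p ! i\<close>.
\<close>

definition partitions2 :: "(nat \<times> nat) set" where
  "partitions2 = {(a, b). b \<le> a}"

definition vertical :: "nat \<times> nat \<Rightarrow> nat \<times> nat \<Rightarrow> bool" where
  "vertical l m \<longleftrightarrow> m = (fst l + 1, snd l)"

definition diagonal :: "nat \<times> nat \<Rightarrow> nat \<times> nat \<Rightarrow> bool" where
  "diagonal l m \<longleftrightarrow> m = (fst l, snd l + 1)"

definition walks :: "nat \<Rightarrow> (nat \<times> nat) list set" where
  "walks n = {p. length p = n + 1 \<and> set p \<subseteq> partitions2 \<and> p ! 0 = (0, 0) \<and>
     (\<forall>i\<in>{1..n}. vertical (p ! (i - 1)) (p ! i) \<or> diagonal (p ! (i - 1)) (p ! i))}"

definition Phi1 :: "'a::field tvec \<Rightarrow> 'a tvec" where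
  "Phi1 b = b \<otimes>\<^sub>V y1 Pos"

text \<open>\<open>Phi2 v m\<close> maps the \<open>(m - 1)\<close>-st tensor power to the \<open>m\<close>-th.\<close>

definition Phi2 :: "'a::field \<Rightarrow> nat \<Rightarrow> 'a tvec \<Rightarrow> 'a tvec" where
  "Phi2 v m b = tscale (qint v (weight_of b)) (b \<otimes>\<^sub>V y1 Neg)
     - tscale (v powi weight_of b) (F_act v (m - 1) b \<otimes>\<^sub>V y1 Pos)"

definition Upsilon :: "'a::field \<Rightarrow> (nat \<times> nat) list \<Rightarrow> nat \<Rightarrow> 'a tvec \<Rightarrow> 'a tvec" where
  "Upsilon v p i = (if vertical (p ! (i - 1)) (p ! i) then Phi1 else Phi2 v i)"

text \<open>\<open>mu v n p\<close> is the vector attached to the first \<open>n\<close> edges of \<open>p\<close>.\<close>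

primrec mu :: "'a::field \<Rightarrow> nat \<Rightarrow> (nat \<times> nat) list \<Rightarrow> 'a tvec" where
  "mu v 0 p = tone"
| "mu v (Suc m) p = Upsilon v p (Suc m) (mu v m p)"

end

theory Submission imports Defs begin

text \<open>
  Everything rests on how the two steps \<open>\<Phi>\<^sub>1\<close> and \<open>\<Phi>\<^sub>2\<close> act on vectors \<open>b\<close>, \<open>c\<close> of the same
  tensor power that are killed by \<open>E\<close> and have weights \<open>i\<close> and \<open>j\<close>. The results are again killed by
  \<open>E\<close>, of weights \<open>i + 1\<close> and \<open>i - 1\<close>, and their inner products are
  \<open>\<langle>\<Phi>\<^sub>1 b, \<Phi>\<^sub>1 c\<rangle> = \<langle>b, c\<rangle>\<close>, \<open>\<langle>\<Phi>\<^sub>1 b, \<Phi>\<^sub>2 c\<rangle> = 0\<close> and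
  \<open>\<langle>\<Phi>\<^sub>2 b, \<Phi>\<^sub>2 c\<rangle> = v [i] [j + 1] \<langle>b, c\<rangle>\<close>
  (\<open>Phi1_singular\<close>, \<open>Phi2_singular\<close>, \<open>form_Phi1_Phi1\<close>, \<open>form_Phi1_Phi2\<close>, \<open>form_Phi2_Phi2\<close>).

  Two facts about the quantum group action give this. The commutator \<open>EF - FE\<close> acts on weight \<open>i\<close> as
  \<open>[i]\<close> (\<open>E_F_commutator\<close>), so \<open>EFb = [i] b\<close> when \<open>Eb = 0\<close>. And \<open>F\<close> is, up to the factor
  \<open>v\<^bsup>-i-1\<^esup>\<close> on weight \<open>i\<close>, the adjoint of \<open>E\<close> (\<open>form_F_act\<close>). Hence \<open>\<langle>b, Fc\<rangle> = 0\<close> and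
  \<open>\<langle>Fb, Fc\<rangle> = v\<^bsup>1-i\<^esup> [i] \<langle>b, c\<rangle>\<close>, and the last inner product above is
  \<open>[i] ([j] + v\<^bsup>j+1\<^esup>) \<langle>b, c\<rangle>\<close>, where \<open>[j] + v\<^bsup>j+1\<^esup> = v [j + 1]\<close> (\<open>qint_plus_1\<close>).

  Now follow the walks edge by edge. After \<open>m\<close> edges of \<open>p\<close> the weight is the difference \<open>i\<close> of the two
  rows of \<open>p\<^sub>m\<close>. A diagonal edge requires \<open>1 \<le> i\<close>, and \<open>i + 1 \<le> m + 1 \<le> n\<close>, so both \<open>[i]\<close> and
  \<open>[i + 1]\<close> are factors of \<open>[n]!\<close> and the norm stays nonzero. Two different walks have orthogonal
  vectors: where they first part, one takes a vertical and the other a diagonal edge, which makes the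
  inner product vanish, and afterwards it can only be multiplied by scalars or be reset to zero.
  Orthogonality and non-isotropy imply injectivity and linear independence.
\<close>

section \<open>Quantum integers\<close>

text \<open>
  For \<open>i \<ge> 0\<close>, the exponents in \<open>[i + 1]\<close> are those in \<open>[i]\<close> lowered by one, together with the new
  largest exponent \<open>i\<close>. Negative \<open>i\<close> are needed as well, because the tensor power has negative weights.
\<close>
lemma qint_plus_1:
  fixes v :: "'a::field"
  assumes v: "v \<noteq> 0"
  shows "qint v (i + 1) = inverse v * qint v i + v powi i"
proof (cases "i \<ge> 0")
  case True
  define k where "k = nat i"
  have i: "i = int k" using True by (simp add: k_def)
  have "qint v (i + 1) = (\<Sum>t<Suc k. v powi (int k - 2 * int t))"
    by (simp add: qint_def i nat_add_distrib del: sum.lessThan_Suc)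
  also have "\<dots> = v powi int k + (\<Sum>t<k. v powi (int k - 2 * int (Suc t)))"
    by (subst sum.lessThan_Suc_shift) simp
  also have "(\<Sum>t<k. v powi (int k - 2 * int (Suc t)))
      = (\<Sum>t<k. inverse v * v powi (int k - 1 - 2 * int t))"
  proof (rule sum.cong[OF refl])
    fix t
    have "int k - 2 * int (Suc t) = -1 + (int k - 1 - 2 * int t)" by simp
    then show "v powi (int k - 2 * int (Suc t)) = inverse v * v powi (int k - 1 - 2 * int t)"
      by (simp only: power_int_add[OF disjI1[OF v]] power_int_minus1_right)
  qed
  finally show ?thesis by (simp add: qint_def i sum_distrib_left)
next
  case False
  define k where "k = nat (- i - 1)"
  have i: "i = - int k - 1" using False by (simp add: k_def)
  \<comment> \<open>For \<open>i < 0\<close> the same recursion is read through \<open>[-k] = -[k]\<close>: now \<open>[i]\<close> is the longer sum,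
      and its last term is the one split off.\<close>
  have qi: "qint v i = - (\<Sum>t<Suc k. v powi (int k - 2 * int t))"
  proof -
    have "nat (- i) = Suc k" using i by simp
    then show ?thesis using False by (simp add: qint_def i del: sum.lessThan_Suc)
  qed
  have qi1: "qint v (i + 1) = - (\<Sum>t<k. v powi (int k - 1 - 2 * int t))"
    by (simp add: qint_def i)
  have "inverse v * (\<Sum>t<Suc k. v powi (int k - 2 * int t))
      = (\<Sum>t<Suc k. v powi (int k - 1 - 2 * int t))"
    unfolding sum_distrib_left
  proof (rule sum.cong[OF refl])
    fix t
    have "int k - 1 - 2 * int t = -1 + (int k - 2 * int t)" by simp
    then show "inverse v * v powi (int k - 2 * int t) = v powi (int k - 1 - 2 * int t)"
      by (simp only: power_int_add[OF disjI1[OF v]] power_int_minus1_right)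
  qed
  also have "\<dots> = (\<Sum>t<k. v powi (int k - 1 - 2 * int t)) + v powi i"
    by (simp add: i)
  finally have "inverse v * (\<Sum>t<Suc k. v powi (int k - 2 * int t))
      = (\<Sum>t<k. v powi (int k - 1 - 2 * int t)) + v powi i" .
  then show ?thesis unfolding qi qi1 by (simp only: mult_minus_right) simp
qed

lemma qint_nonzero:
  assumes "qfact v n \<noteq> 0" "1 \<le> k" "k \<le> n"
  shows "qint v (int k) \<noteq> 0"
  using assms by (auto simp: qfact_def)

section \<open>Splitting off the last tensor factor\<close>

text \<open>
  The steps of a walk append a tensor factor on the right, so inductions on the tensor power peel off
  the last factor: \<open>x\<close> is the sum of \<open>slice x i \<otimes>\<^sub>V y\<^sub>i\<close> over the two indices \<open>i\<close>.
\<close>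
definition slice :: "'a::field tvec \<Rightarrow> ind \<Rightarrow> 'a tvec" where
  "slice x i = (\<lambda>s. x (s @ [i]))"

lemma tscale_apply: "tscale c x s = c * x s"
  by (simp add: tscale_def)

lemma slice_apply: "slice x i s = x (s @ [i])"
  by (simp add: slice_def)

text \<open>
  Vectors are kept opaque during simplification; coordinates are exposed only on demand, by
  \<open>pointwise\<close>.
\<close>

declare plus_fun_apply [simp del] zero_fun_apply [simp del] minus_apply [simp del]

lemmas pointwise =
  fun_eq_iff plus_fun_apply zero_fun_apply minus_apply tscale_apply slice_apply

lemma tscale_trivial [simp]: "tscale 0 x = 0" "tscale 1 x = x" "tscale c 0 = 0"
  by (simp_all add: pointwise)

lemma slice_add [simp]: "slice (x + y) i = slice x i + slice y i"
  by (simp add: pointwise)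

lemma slice_diff [simp]: "slice (x - y) i = slice x i - slice y i"
  by (simp add: pointwise)

lemma slice_tscale [simp]: "slice (tscale c x) i = tscale c (slice x i)"
  by (simp add: pointwise)

lemma slice_zero [simp]: "slice 0 i = 0"
  by (simp add: pointwise)

lemma slice_sum: "slice (sum f A) i = (\<Sum>a\<in>A. slice (f a) i)"
  by (induction A rule: infinite_finite_induct) simp_all

lemma slice_tsnoc [simp]: "slice (b \<otimes>\<^sub>V u) i = tscale (u i) b"
  by (simp add: pointwise tsnoc_def)

lemma slice_in_tensor_power [simp]:
  "x \<in> tensor_power (Suc n) \<Longrightarrow> slice x i \<in> tensor_power n"
  by (simp add: tensor_power_def pointwise)

lemma tensor_eqI:
  assumes "x \<in> tensor_power (Suc n)" "y \<in> tensor_power (Suc n)"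
    and "slice x Pos = slice y Pos" "slice x Neg = slice y Neg"
  shows "x = y"
proof
  fix s
  show "x s = y s"
  proof (cases s rule: rev_cases)
    case Nil
    then show ?thesis using assms(1,2) by (simp add: tensor_power_def pointwise)
  next
    case (snoc t i)
    then show ?thesis
      using fun_cong[OF assms(3), of t] fun_cong[OF assms(4), of t]
      by (cases i) (simp_all add: slice_apply)
  qed
qed

lemma tensor_power_add [simp]:
  "x \<in> tensor_power n \<Longrightarrow> y \<in> tensor_power n \<Longrightarrow> x + y \<in> tensor_power n"
  by (simp add: tensor_power_def pointwise)

lemma tensor_power_diff [simp]:
  "x \<in> tensor_power n \<Longrightarrow> y \<in> tensor_power n \<Longrightarrow> x - y \<in> tensor_power n"
  by (simp add: tensor_power_def pointwise)

lemma tensor_power_tscale [simp]: "x \<in> tensor_power n \<Longrightarrow> tscale c x \<in> tensor_power n"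
  by (simp add: tensor_power_def pointwise)

lemma tensor_power_zero [simp]: "0 \<in> tensor_power n"
  by (simp add: tensor_power_def pointwise)

lemma tensor_power_sum:
  "(\<And>a. a \<in> A \<Longrightarrow> f a \<in> tensor_power n) \<Longrightarrow> sum f A \<in> tensor_power n"
  by (induction A rule: infinite_finite_induct) simp_all

lemma tsnoc_in_tensor_power [simp]:
  "b \<in> tensor_power n \<Longrightarrow> b \<otimes>\<^sub>V u \<in> tensor_power (Suc n)"
proof -
  assume b: "b \<in> tensor_power n"
  have "length (butlast s) \<noteq> n" if "s \<noteq> []" "length s \<noteq> Suc n" for s :: "ind list"
    using that by (cases s rule: rev_cases) auto
  with b show ?thesis by (simp add: tensor_power_def tsnoc_def)
qed

lemma tensor_op_in_tensor_power: "length As = n \<Longrightarrow> tensor_op As x \<in> tensor_power n"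
  by (simp add: tensor_power_def tensor_op_def)

lemma E_act_in_tensor_power [simp]: "E_act v n x \<in> tensor_power n"
  unfolding E_act_def by (intro tensor_power_sum tensor_op_in_tensor_power) auto

lemma F_act_in_tensor_power [simp]: "F_act v n x \<in> tensor_power n"
  unfolding F_act_def by (intro tensor_power_sum tensor_op_in_tensor_power) auto

section \<open>The bilinear form\<close>

lemma finite_ind_lists: "finite {t :: ind list. length t = n}"
proof -
  have "(UNIV :: ind set) = {Pos, Neg}" by (auto intro: ind.exhaust)
  then have "finite (UNIV :: ind set)" by (metis finite.emptyI finite.insertI)
  from finite_lists_length_eq[OF this, of n] show ?thesis by simp
qed

lemma sum_ind_lists_Suc:
  fixes f :: "ind list \<Rightarrow> 'b::comm_monoid_add"
  shows "(\<Sum>t | length t = Suc n. f t) = (\<Sum>t | length t = n. f (t @ [Pos]) + f (t @ [Neg]))"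
proof -
  let ?L = "{t :: ind list. length t = n}"
  have split: "{t :: ind list. length t = Suc n} = (\<lambda>t. t @ [Pos]) ` ?L \<union> (\<lambda>t. t @ [Neg]) ` ?L"
    (is "?S = ?P \<union> ?N")
  proof (intro equalityI subsetI)
    fix t :: "ind list" assume "t \<in> ?S"
    then obtain s i where "t = s @ [i]" "length s = n"
      by (cases t rule: rev_cases) auto
    then show "t \<in> ?P \<union> ?N" by (cases i) auto
  qed auto
  have "sum f ?S = sum f ?P + sum f ?N"
    unfolding split by (rule sum.union_disjoint) (auto simp: finite_ind_lists)
  also have "sum f ?P = (\<Sum>t\<in>?L. f (t @ [Pos]))"
    by (subst sum.reindex) (auto simp: inj_on_def)
  also have "sum f ?N = (\<Sum>t\<in>?L. f (t @ [Neg]))"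
    by (subst sum.reindex) (auto simp: inj_on_def)
  finally show ?thesis by (simp add: sum.distrib)
qed

lemma form_Suc:
  "form (Suc n) x y = form n (slice x Pos) (slice y Pos) + form n (slice x Neg) (slice y Neg)"
  by (simp add: form_def pointwise sum_ind_lists_Suc sum.distrib)

lemma form_add [simp]:
  "form n (x + y) z = form n x z + form n y z"
  "form n z (x + y) = form n z x + form n z y"
  by (simp_all add: form_def pointwise algebra_simps sum.distrib)

lemma form_tscale [simp]:
  "form n (tscale c x) y = c * form n x y"
  "form n x (tscale c y) = c * form n x y"
  by (simp_all add: form_def pointwise sum_distrib_left mult_ac)

lemma form_zero [simp]: "form n 0 x = 0" "form n x 0 = 0"
  by (simp_all add: form_def pointwise)

lemma form_sum: "form n (sum f A) z = (\<Sum>a\<in>A. form n (f a) z)"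
  by (induction A rule: infinite_finite_induct) simp_all

lemma form_commute: "form n x y = form n y x"
  by (simp add: form_def pointwise mult.commute)

section \<open>Tensor products of operators\<close>

lemma slice_tensor_op:
  "slice (tensor_op (As @ [A]) x) i
     = tscale (A Pos i) (tensor_op As (slice x Pos)) + tscale (A Neg i) (tensor_op As (slice x Neg))"
proof
  fix s
  show "slice (tensor_op (As @ [A]) x) i s
      = (tscale (A Pos i) (tensor_op As (slice x Pos))
         + tscale (A Neg i) (tensor_op As (slice x Neg))) s"
  proof (cases "length s = length As")
    case True
    have "(\<Prod>j<Suc (length As). ((As @ [A]) ! j) ((t @ [k]) ! j) ((s @ [i]) ! j))
        = (\<Prod>j<length As. (As ! j) (t ! j) (s ! j)) * A k i"
      if "length t = length As" for t k
      using that True by (simp add: nth_append)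
    then show ?thesis
      using True
      by (simp add: tensor_op_def pointwise sum_ind_lists_Suc sum.distrib sum_distrib_left mult_ac
          del: prod.lessThan_Suc)
  next
    case False
    then show ?thesis by (simp add: tensor_op_def pointwise)
  qed
qed

lemma tensor_op_add: "tensor_op As (x + y) = tensor_op As x + tensor_op As y"
  by (simp add: tensor_op_def pointwise pointwise algebra_simps sum.distrib)

lemma tensor_op_tscale: "tensor_op As (tscale c x) = tscale c (tensor_op As x)"
  by (simp add: tensor_op_def pointwise pointwise sum_distrib_left mult_ac)

lemma tensor_op_zero: "tensor_op As 0 = 0"
  by (simp add: tensor_op_def pointwise pointwise)

lemma tscale_sum: "tscale c (sum f A) = (\<Sum>a\<in>A. tscale c (f a))"
  by (induction A rule: infinite_finite_induct) (simp_all add: pointwise algebra_simps)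

lemma E_act_add [simp]: "E_act v n (x + y) = E_act v n x + E_act v n y"
  by (simp add: E_act_def tensor_op_add sum.distrib)

lemma E_act_tscale [simp]: "E_act v n (tscale c x) = tscale c (E_act v n x)"
  by (simp add: E_act_def tensor_op_tscale tscale_sum)

lemma E_act_zero [simp]: "E_act v n 0 = 0"
  by (simp add: E_act_def tensor_op_zero)

lemma F_act_add [simp]: "F_act v n (x + y) = F_act v n x + F_act v n y"
  by (simp add: F_act_def tensor_op_add sum.distrib)

lemma F_act_tscale [simp]: "F_act v n (tscale c x) = tscale c (F_act v n x)"
  by (simp add: F_act_def tensor_op_tscale tscale_sum)

lemma F_act_zero [simp]: "F_act v n 0 = 0"
  by (simp add: F_act_def tensor_op_zero)

section \<open>Weights\<close>

lemma has_weight_slice: "has_weight i x \<Longrightarrow> has_weight (i - ind_val k) (slice x k)"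
  unfolding has_weight_def by (force simp: slice_apply algebra_simps)

lemma has_weight_slices [simp]:
  assumes "has_weight i x"
  shows "has_weight (i - 1) (slice x Pos)" "has_weight (i + 1) (slice x Neg)"
  using has_weight_slice[OF assms, of Pos] has_weight_slice[OF assms, of Neg] by simp_all

lemma has_weight_SucI:
  assumes "x \<in> tensor_power (Suc n)"
    and "has_weight (i - 1) (slice x Pos)" "has_weight (i + 1) (slice x Neg)"
  shows "has_weight i x"
  unfolding has_weight_def
proof (intro allI impI)
  fix s assume s: "x s \<noteq> 0"
  with assms(1) have "length s = Suc n" by (auto simp: tensor_power_def)
  then obtain t k where t: "s = t @ [k]" by (cases s rule: rev_cases) auto
  show "(\<Sum>k\<leftarrow>s. ind_val k) = i"
    using s assms(2,3) t unfolding has_weight_def by (cases k) (auto simp: slice_apply)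
qed

lemma has_weight_add [simp]: "has_weight i x \<Longrightarrow> has_weight i y \<Longrightarrow> has_weight i (x + y)"
  unfolding has_weight_def by (metis add_0 plus_fun_apply)

lemma has_weight_tscale [simp]: "has_weight i x \<Longrightarrow> has_weight i (tscale c x)"
  unfolding has_weight_def by (auto simp: pointwise)

lemma has_weight_zero [simp]: "has_weight i 0"
  unfolding has_weight_def by (auto simp: pointwise)

lemma weight_of_eq:
  assumes "has_weight i x" "x \<noteq> 0"
  shows "weight_of x = i"
proof -
  obtain s where "x s \<noteq> 0" using assms(2) by (auto simp: pointwise)
  then show ?thesis
    unfolding weight_of_def using assms(1) by (intro the_equality) (auto simp: has_weight_def)
qed

section \<open>The action of E and F through the last factor\<close>

lemma tensor_op_nil: "x \<in> tensor_power 0 \<Longrightarrow> tensor_op [] x = x"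
  by (auto simp: tensor_op_def tensor_power_def fun_eq_iff)

lemma tensor_op_id: "x \<in> tensor_power n \<Longrightarrow> tensor_op (replicate n id1) x = x"
proof (induction n arbitrary: x)
  case 0
  then show ?case by (simp add: tensor_op_nil)
next
  case (Suc n)
  have r: "replicate (Suc n) id1 = replicate n id1 @ [id1]" by (simp add: replicate_append_same)
  show ?case
    by (rule tensor_eqI[OF tensor_op_in_tensor_power Suc.prems])
      (simp_all only: r slice_tensor_op Suc.IH[OF slice_in_tensor_power[OF Suc.prems]],
       simp_all add: id1_def y1_def pointwise)
qed

lemma tensor_op_K:
  assumes v: "v \<noteq> 0"
  shows "x \<in> tensor_power n \<Longrightarrow> has_weight i x \<Longrightarrow>
    tensor_op (replicate n (K1 v)) x = tscale (v powi i) x"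
proof (induction n arbitrary: x i)
  case 0
  then have "v powi i * x s = x s" for s
    by (cases "s = []") (auto simp: has_weight_def tensor_power_def)
  with 0 show ?case by (simp add: tensor_op_nil pointwise)
next
  case (Suc n)
  have r: "replicate (Suc n) (K1 v) = replicate n (K1 v) @ [K1 v]"
    by (simp add: replicate_append_same)
  have IH: "tensor_op (replicate n (K1 v)) (slice x Pos) = tscale (v powi (i - 1)) (slice x Pos)"
    "tensor_op (replicate n (K1 v)) (slice x Neg) = tscale (v powi (i + 1)) (slice x Neg)"
    using Suc by simp_all
  show ?case
    by (rule tensor_eqI[OF tensor_op_in_tensor_power tensor_power_tscale[OF Suc.prems(1)]])
      (simp_all only: r slice_tensor_op IH,
       simp_all add: v K1_def y1_def pointwise power_int_add power_int_diff power_int_minus)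
qed

text \<open>
  This is the coproduct rule \<open>\<Delta>(E) = E \<otimes> 1 + K \<otimes> E\<close>, with \<open>E y\<^bsub>-1\<^esub> = y\<^sub>1\<close>. The slice of \<open>x\<close> at
  \<open>Neg\<close> has weight \<open>i + 1\<close>, which is the exponent with which \<open>K\<close> acts on it.
\<close>
lemma slice_E_act:
  assumes v: "v \<noteq> 0" and x: "x \<in> tensor_power (Suc n)" "has_weight i x"
  shows "slice (E_act v (Suc n) x) Pos
      = E_act v n (slice x Pos) + tscale (v powi (i + 1)) (slice x Neg)" (is ?P)
    and "slice (E_act v (Suc n) x) Neg = E_act v n (slice x Neg)" (is ?N)
proof -
  \<comment> \<open>The summands with \<open>j \<le> n\<close> act on the last factor by a diagonal operator; the summand
      \<open>j = Suc n\<close> is kept apart.\<close>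
  have r: "replicate (j - 1) (K1 v) @ [E1] @ replicate (Suc n - j) id1
      = (replicate (j - 1) (K1 v) @ [E1] @ replicate (n - j) id1) @ [id1]"
    if "j \<in> {1..n}" for j
    using that by (simp add: Suc_diff_le replicate_append_same)
  have *: "slice (E_act v (Suc n) x) k = E_act v n (slice x k)
      + slice (tensor_op (replicate n (K1 v) @ [E1]) x) k" for k
  proof -
    have "slice (E_act v (Suc n) x) k
        = (\<Sum>j=1..n. slice (tensor_op
              (replicate (j - 1) (K1 v) @ [E1] @ replicate (Suc n - j) id1) x) k)
          + slice (tensor_op (replicate n (K1 v) @ [E1]) x) k"
      by (simp add: E_act_def slice_sum)
    also have "(\<Sum>j=1..n. slice (tensor_op
              (replicate (j - 1) (K1 v) @ [E1] @ replicate (Suc n - j) id1) x) k)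
        = (\<Sum>j=1..n. tensor_op (replicate (j - 1) (K1 v) @ [E1] @ replicate (n - j) id1) (slice x k))"
      by (rule sum.cong[OF refl], simp only: r slice_tensor_op, cases k)
        (simp_all add: id1_def y1_def pointwise)
    finally show ?thesis by (simp add: E_act_def)
  qed
  show ?P unfolding * slice_tensor_op
    using tensor_op_K[OF v, of "slice x Neg" n "i + 1"] x
    by (simp add: y1_def pointwise)
  show ?N unfolding * slice_tensor_op
    by (simp add: y1_def pointwise)
qed

text \<open>The coproduct rule \<open>\<Delta>(F) = F \<otimes> K\<^bsup>-1\<^esup> + 1 \<otimes> F\<close>, with \<open>F y\<^sub>1 = y\<^bsub>-1\<^esub>\<close>.\<close>
lemma slice_F_act:
  assumes x: "x \<in> tensor_power (Suc n)"
  shows "slice (F_act v (Suc n) x) Pos = tscale (inverse v) (F_act v n (slice x Pos))" (is ?P)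
    and "slice (F_act v (Suc n) x) Neg
      = tscale v (F_act v n (slice x Neg)) + slice x Pos" (is ?N)
proof -
  have r: "replicate (j - 1) id1 @ [F1] @ replicate (Suc n - j) (Kinv1 v)
      = (replicate (j - 1) id1 @ [F1] @ replicate (n - j) (Kinv1 v)) @ [Kinv1 v]"
    if "j \<in> {1..n}" for j
    using that by (simp add: Suc_diff_le replicate_append_same)
  have *: "slice (F_act v (Suc n) x) k = tscale (v powi (- ind_val k)) (F_act v n (slice x k))
      + slice (tensor_op (replicate n id1 @ [F1]) x) k" for k
  proof -
    have "slice (F_act v (Suc n) x) k
        = (\<Sum>j=1..n. slice (tensor_op
              (replicate (j - 1) id1 @ [F1] @ replicate (Suc n - j) (Kinv1 v)) x) k)
          + slice (tensor_op (replicate n id1 @ [F1]) x) k"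
      by (simp add: F_act_def slice_sum)
    also have "(\<Sum>j=1..n. slice (tensor_op
              (replicate (j - 1) id1 @ [F1] @ replicate (Suc n - j) (Kinv1 v)) x) k)
        = (\<Sum>j=1..n. tscale (v powi (- ind_val k))
             (tensor_op (replicate (j - 1) id1 @ [F1] @ replicate (n - j) (Kinv1 v)) (slice x k)))"
      by (rule sum.cong[OF refl], simp only: r slice_tensor_op, cases k)
        (simp_all add: Kinv1_def y1_def pointwise)
    finally show ?thesis by (simp add: F_act_def tscale_sum)
  qed
  show ?P unfolding * slice_tensor_op
    by (simp add: y1_def pointwise power_int_minus)
  show ?N unfolding * slice_tensor_op
    using tensor_op_id[of "slice x Pos" n] x
    by (simp add: y1_def pointwise)
qed

text \<open>
  The weight grading is finer than the decomposition into eigenspaces of \<open>K\<close> when \<open>v\<close> is a root of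
  unity, so this cannot be read off from \<open>K F = v\<^bsup>-2\<^esup> F K\<close>; it is proved by
  peeling off the last factor.
\<close>
lemma F_act_weight:
  "x \<in> tensor_power n \<Longrightarrow> has_weight i x \<Longrightarrow> has_weight (i - 2) (F_act v n x)"
proof (induction n arbitrary: x i)
  case 0
  then show ?case by (simp add: F_act_def)
next
  case (Suc n)
  have "has_weight (i - 2 - 1) (F_act v n (slice x Pos))"
    using Suc.IH[of "slice x Pos" "i - 1"] Suc.prems by (simp add: algebra_simps)
  moreover have "has_weight (i - 2 + 1) (F_act v n (slice x Neg))"
    using Suc.IH[of "slice x Neg" "i + 1"] Suc.prems by simp
  moreover have "has_weight (i - 2 + 1) (slice x Pos)"
    using has_weight_slices(1)[OF Suc.prems(2)] by (simp add: algebra_simps)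
  ultimately show ?case
    by (intro has_weight_SucI[OF F_act_in_tensor_power])
      (simp_all only: slice_F_act[OF Suc.prems(1)] has_weight_add has_weight_tscale)
qed

section \<open>Commutator and adjoint\<close>

text \<open>
  The quantum group relation \<open>EF - FE = (K - K\<^bsup>-1\<^esup>)/(v - v\<^bsup>-1\<^esup>)\<close>, in a form that also makes sense for
  \<open>v\<^sup>2 = 1\<close>. Peeling off the last factor, the mixed terms cancel (at \<open>Pos\<close> those with \<open>F\<close> of the
  slice at \<open>Neg\<close>, at \<open>Neg\<close> those with \<open>E\<close> of the slice at \<open>Pos\<close>), and what remains of the scalars
  is the recursion \<open>[i] = v\<^bsup>-1\<^esup> [i - 1] + v\<^bsup>i-1\<^esup>\<close> on the slice at \<open>Pos\<close> and
  \<open>v [i + 1] = [i] + v\<^bsup>i+1\<^esup>\<close> on the slice at \<open>Neg\<close>.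
\<close>
lemma E_F_commutator:
  fixes v :: "'a::field"
  assumes v: "v \<noteq> 0"
  shows "x \<in> tensor_power n \<Longrightarrow> has_weight i x \<Longrightarrow>
    E_act v n (F_act v n x) = F_act v n (E_act v n x) + tscale (qint v i) x"
proof (induction n arbitrary: x i)
  case 0
  then have "qint v i * x s = 0" for s
    by (cases "s = []") (auto simp: has_weight_def tensor_power_def qint_def)
  then show ?case by (simp add: E_act_def F_act_def pointwise)
next
  case (Suc n)
  let ?E = "E_act v n" and ?F = "F_act v n" and ?x = "slice x Pos" and ?y = "slice x Neg"
  note x = Suc.prems
  have Fx: "F_act v (Suc n) x \<in> tensor_power (Suc n)" "has_weight (i - 2) (F_act v (Suc n) x)"
    using F_act_weight[OF x] by simp_all
  have Ex: "E_act v (Suc n) x \<in> tensor_power (Suc n)" by simp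
  have IHP: "?E (?F ?x) = ?F (?E ?x) + tscale (qint v (i - 1)) ?x"
    and IHN: "?E (?F ?y) = ?F (?E ?y) + tscale (qint v (i + 1)) ?y"
    using Suc.IH x by simp_all
  have q1: "qint v i = inverse v * qint v (i - 1) + v powi (i - 1)"
    using qint_plus_1[OF v, of "i - 1"] by simp
  have q2: "v * qint v (i + 1) = qint v i + v powi (i + 1)"
    using qint_plus_1[OF v, of i] v by (simp add: field_simps power_int_add)
  show ?case
  proof (rule tensor_eqI[where n = n])
    have EF: "slice (E_act v (Suc n) (F_act v (Suc n) x)) Pos
        = tscale (inverse v) (?F (?E ?x) + tscale (qint v (i - 1)) ?x)
          + tscale (v powi (i - 1)) (tscale v (?F ?y) + ?x)"
      using slice_E_act(1)[OF v Fx] by (simp add: slice_F_act[OF x(1)] IHP)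
    have FE: "slice (F_act v (Suc n) (E_act v (Suc n) x)) Pos
        = tscale (inverse v) (?F (?E ?x) + tscale (v powi (i + 1)) (?F ?y))"
      by (simp add: slice_F_act[OF Ex] slice_E_act[OF v x])
    have "inverse v * v powi (i + 1) = v powi (i - 1) * v"
      using v by (simp add: power_int_add power_int_diff)
    then have "inverse v * (f + qint v (i - 1) * a) + v powi (i - 1) * (v * g + a)
        = inverse v * (f + v powi (i + 1) * g) + qint v i * a" for f a g
      using q1 by algebra
    then show "slice (E_act v (Suc n) (F_act v (Suc n) x)) Pos
        = slice (F_act v (Suc n) (E_act v (Suc n) x) + tscale (qint v i) x) Pos"
      unfolding slice_add slice_tscale EF FE fun_eq_iff plus_fun_apply tscale_apply by blast
  next
    have EF: "slice (E_act v (Suc n) (F_act v (Suc n) x)) Neg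
        = tscale v (?F (?E ?y) + tscale (qint v (i + 1)) ?y) + ?E ?x"
      using slice_E_act(2)[OF v Fx] by (simp add: slice_F_act[OF x(1)] IHN)
    have FE: "slice (F_act v (Suc n) (E_act v (Suc n) x)) Neg
        = tscale v (?F (?E ?y)) + (?E ?x + tscale (v powi (i + 1)) ?y)"
      by (simp add: slice_F_act[OF Ex] slice_E_act[OF v x])
    have "v * (f + qint v (i + 1) * a) + g = v * f + (g + v powi (i + 1) * a) + qint v i * a"
      for f a g
      using q2 by algebra
    then show "slice (E_act v (Suc n) (F_act v (Suc n) x)) Neg
        = slice (F_act v (Suc n) (E_act v (Suc n) x) + tscale (qint v i) x) Neg"
      unfolding slice_add slice_tscale EF FE fun_eq_iff plus_fun_apply tscale_apply by blast
  qed (use x in simp_all)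
qed

text \<open>
  On \<open>V\<close> the transpose of \<open>F\<close> is \<open>E\<close>, so on the tensor power the transpose of \<open>F\<close> is the sum over \<open>j\<close>
  of \<open>1 \<otimes> \<dots> \<otimes> E \<otimes> K\<^bsup>-1\<^esup> \<otimes> \<dots> \<otimes> K\<^bsup>-1\<^esup>\<close>, with \<open>E\<close> in place \<open>j\<close>; this is \<open>v K\<^bsup>-1\<^esup> E\<close>. As \<open>E x\<close>
  has weight \<open>i + 2\<close>, the factor is \<open>v\<^bsup>1 - (i + 2)\<^esup>\<close>.
\<close>
lemma form_F_act:
  fixes v :: "'a::field"
  assumes v: "v \<noteq> 0"
  shows "x \<in> tensor_power n \<Longrightarrow> has_weight i x \<Longrightarrow> y \<in> tensor_power n \<Longrightarrow>
    form n x (F_act v n y) = v powi (- i - 1) * form n (E_act v n x) y"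
proof (induction n arbitrary: x i y)
  case 0
  then show ?case by (simp add: E_act_def F_act_def)
next
  case (Suc n)
  let ?E = "E_act v n" and ?F = "F_act v n"
  have IHP: "form n (slice x Pos) (?F (slice y Pos))
      = v powi (- i) * form n (?E (slice x Pos)) (slice y Pos)"
    using Suc.IH[of "slice x Pos" "i - 1" "slice y Pos"] Suc.prems by simp
  have IHN: "form n (slice x Neg) (?F (slice y Neg))
      = v powi (- i - 2) * form n (?E (slice x Neg)) (slice y Neg)"
  proof -
    have e: "- i - 2 = - (i + 1) - 1" by simp
    show ?thesis unfolding e by (rule Suc.IH) (use Suc.prems in simp_all)
  qed
  have "inverse v * v powi (- i) = v powi (- i - 1)" "v * v powi (- i - 2) = v powi (- i - 1)"
    "v powi (- i - 1) * v powi (i + 1) = 1"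
    using v by (simp_all add: power_int_diff power_int_minus power_int_add field_simps
        power2_eq_square)
  then show ?case
    by (simp add: form_Suc slice_F_act[OF Suc.prems(3)] slice_E_act[OF v Suc.prems(1,2)]
        IHP IHN distrib_left mult.assoc[symmetric])
qed

section \<open>The two steps on singular vectors\<close>

text \<open>
  Compared with maximality, a weight is prescribed and the zero vector is admitted; that no zero vector
  occurs along a walk is a consequence of non-isotropy.
\<close>
definition singular_of_weight :: "'a::field \<Rightarrow> nat \<Rightarrow> int \<Rightarrow> 'a tvec \<Rightarrow> bool" where
  "singular_of_weight v n i b \<longleftrightarrow> b \<in> tensor_power n \<and> has_weight i b \<and> E_act v n b = 0"

text \<open>\<open>Phi2\<close> with the weight as a parameter, which makes it linear and free of \<open>weight_of\<close>.\<close>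
definition Phi2_at :: "'a::field \<Rightarrow> nat \<Rightarrow> int \<Rightarrow> 'a tvec \<Rightarrow> 'a tvec" where
  "Phi2_at v n i b = tscale (qint v i) (b \<otimes>\<^sub>V y1 Neg) - tscale (v powi i) (F_act v n b \<otimes>\<^sub>V y1 Pos)"

lemma slice_Phi1 [simp]: "slice (Phi1 b) Pos = b" "slice (Phi1 b) Neg = 0"
  by (simp_all add: Phi1_def y1_def)

lemma slice_Phi2_at [simp]:
  "slice (Phi2_at v n i b) Pos = tscale (- (v powi i)) (F_act v n b)"
  "slice (Phi2_at v n i b) Neg = tscale (qint v i) b"
  by (simp_all add: Phi2_at_def y1_def) (simp add: pointwise)

lemma Phi1_singular:
  assumes v: "v \<noteq> 0" and b: "singular_of_weight v n i b"
  shows "singular_of_weight v (Suc n) (i + 1) (Phi1 b)"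
proof -
  have t: "Phi1 b \<in> tensor_power (Suc n)"
    using b by (simp add: singular_of_weight_def Phi1_def)
  have w: "has_weight (i + 1) (Phi1 b)"
    using b by (intro has_weight_SucI[OF t]) (simp_all add: singular_of_weight_def)
  have "E_act v (Suc n) (Phi1 b) = 0"
    by (rule tensor_eqI[where n = n])
      (use b in \<open>simp_all add: slice_E_act[OF v t w] singular_of_weight_def\<close>)
  with t w show ?thesis by (simp add: singular_of_weight_def)
qed

lemma E_F_singular:
  assumes v: "v \<noteq> 0" and b: "singular_of_weight v n i b"
  shows "E_act v n (F_act v n b) = tscale (qint v i) b"
  using E_F_commutator[OF v, of b n i] b by (simp add: singular_of_weight_def)

text \<open>
  The scalars in \<open>\<Phi>\<^sub>2\<close> are chosen for this: \<open>E\<close> sends \<open>b \<otimes> y\<^bsub>-1\<^esub>\<close> to \<open>v\<^bsup>i\<^esup> b \<otimes> y\<^sub>1\<close> and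
  \<open>Fb \<otimes> y\<^sub>1\<close> to \<open>[i] b \<otimes> y\<^sub>1\<close>, so with the
  coefficients \<open>[i]\<close> and \<open>- v\<^bsup>i\<^esup>\<close> the two contributions cancel.
\<close>
lemma Phi2_singular:
  assumes v: "v \<noteq> 0" and b: "singular_of_weight v n i b"
  shows "singular_of_weight v (Suc n) (i - 1) (Phi2_at v n i b)"
proof -
  have b': "b \<in> tensor_power n" "has_weight i b" "E_act v n b = 0"
    using b by (simp_all add: singular_of_weight_def)
  have t: "Phi2_at v n i b \<in> tensor_power (Suc n)"
    using b' by (simp add: Phi2_at_def)
  have w: "has_weight (i - 1) (Phi2_at v n i b)"
    using b' F_act_weight[OF b'(1,2)] by (intro has_weight_SucI[OF t]) simp_all
  have "E_act v (Suc n) (Phi2_at v n i b) = 0"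
    by (rule tensor_eqI[where n = n])
      (simp_all add: slice_E_act[OF v t w] E_F_singular[OF v b] b'(3), simp add: pointwise)
  with t w show ?thesis by (simp add: singular_of_weight_def)
qed

lemma form_Phi1_Phi1: "form (Suc n) (Phi1 b) (Phi1 c) = form n b c"
  by (simp add: form_Suc)

text \<open>Only the component along \<open>y\<^sub>1\<close> contributes, and it is a multiple of \<open>\<langle>b, Fc\<rangle>\<close>, hence of \<open>\<langle>Eb, c\<rangle>\<close>.\<close>
lemma form_Phi1_Phi2:
  assumes v: "v \<noteq> 0" and b: "singular_of_weight v n i b" and c: "c \<in> tensor_power n"
  shows "form (Suc n) (Phi1 b) (Phi2_at v n j c) = 0"
  using form_F_act[OF v, of b n i c] b c by (simp add: form_Suc singular_of_weight_def)

text \<open>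
  Moving one \<open>F\<close> across the form turns \<open>\<langle>Fb, Fc\<rangle>\<close> into a multiple of \<open>\<langle>EFb, c\<rangle> = [i] \<langle>b, c\<rangle>\<close>. The
  weight of \<open>c\<close> enters only through the scalars of \<open>\<Phi>\<^sub>2\<close>, so the formula holds for arbitrary \<open>c\<close> and
  \<open>j\<close>, and unequal weights need no separate treatment.
\<close>
lemma form_Phi2_Phi2:
  assumes v: "v \<noteq> 0" and b: "singular_of_weight v n i b" and c: "c \<in> tensor_power n"
  shows "form (Suc n) (Phi2_at v n i b) (Phi2_at v n j c)
    = qint v i * (v * qint v (j + 1)) * form n b c"
proof -
  have b': "b \<in> tensor_power n" "has_weight i b" using b by (simp_all add: singular_of_weight_def)
  have "form n (F_act v n b) (F_act v n c) = v powi (1 - i) * (qint v i * form n b c)"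
    using form_F_act[OF v _ F_act_weight[OF b'] c] E_F_singular[OF v b] by simp
  moreover have "v powi i * v powi j * v powi (1 - i) = v powi (j + 1)"
    using v by (simp add: power_int_add power_int_diff)
  moreover have "v * qint v (j + 1) = qint v j + v powi (j + 1)"
    using qint_plus_1[OF v, of j] v by (simp add: field_simps power_int_add)
  ultimately show ?thesis
    by (simp add: form_Suc) (simp add: algebra_simps)
qed

section \<open>Walks\<close>

text \<open>The weight of the vectors attached to walks that end at the partition \<open>l\<close>.\<close>
definition shape_weight :: "nat \<times> nat \<Rightarrow> int" where
  "shape_weight l = int (fst l) - int (snd l)"

lemma walk_step:
  assumes "p \<in> walks n" "m < n"
  shows "vertical (p ! m) (p ! Suc m) \<or> diagonal (p ! m) (p ! Suc m)"
proof -
  have "Suc m \<in> {1..n}" using assms(2) by simp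
  with assms(1) show ?thesis unfolding walks_def by fastforce
qed

lemma walk_vertex:
  assumes p: "p \<in> walks n" and "m \<le> n"
  shows "snd (p ! m) \<le> fst (p ! m)" "fst (p ! m) + snd (p ! m) = m"
proof -
  have "p ! m \<in> partitions2"
    using assms by (auto simp: walks_def intro: nth_mem)
  then show "snd (p ! m) \<le> fst (p ! m)" by (auto simp: partitions2_def)
  from \<open>m \<le> n\<close> show "fst (p ! m) + snd (p ! m) = m"
  proof (induction m)
    case 0
    then show ?case using p by (simp add: walks_def)
  next
    case (Suc m)
    then show ?case using walk_step[OF p, of m] by (auto simp: vertical_def diagonal_def)
  qed
qed

section \<open>The vectors attached to walks\<close>

lemma Phi2_eq_Phi2_at: "has_weight i b \<Longrightarrow> Phi2 v (Suc n) b = Phi2_at v n i b"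
proof (cases "b = 0")
  \<comment> \<open>For \<open>b = 0\<close> the value of \<open>weight_of\<close> is unspecified, but both sides vanish.\<close>
  case True
  have "(0 :: 'a tvec) \<otimes>\<^sub>V u = 0" for u :: "'a vec1"
    by (simp add: tsnoc_def pointwise)
  then show ?thesis by (simp add: True Phi2_def Phi2_at_def)
qed (simp add: Phi2_def Phi2_at_def weight_of_eq)

lemma mu_Suc_eq:
  assumes "singular_of_weight v m (shape_weight (p ! m)) (mu v m p)"
  shows "mu v (Suc m) p = (if vertical (p ! m) (p ! Suc m) then Phi1 (mu v m p)
    else Phi2_at v m (shape_weight (p ! m)) (mu v m p))"
  using assms by (simp add: Upsilon_def Phi2_eq_Phi2_at singular_of_weight_def del: mu.simps(1))

lemma mu_singular_of_weight:
  assumes v: "v \<noteq> 0" and p: "p \<in> walks n"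
  shows "m \<le> n \<Longrightarrow> singular_of_weight v m (shape_weight (p ! m)) (mu v m p)"
proof (induction m)
  case 0
  then show ?case
    using p by (auto simp: singular_of_weight_def has_weight_def tone_def tensor_power_def
        shape_weight_def walks_def E_act_def)
next
  case (Suc m)
  then have b: "singular_of_weight v m (shape_weight (p ! m)) (mu v m p)" by simp
  have "vertical (p ! m) (p ! Suc m) \<or> diagonal (p ! m) (p ! Suc m)"
    using walk_step[OF p] Suc.prems by simp
  then have "shape_weight (p ! Suc m)
      = shape_weight (p ! m) + (if vertical (p ! m) (p ! Suc m) then 1 else - 1)"
    by (auto simp: vertical_def diagonal_def shape_weight_def)
  then show ?case
    using Phi1_singular[OF v b] Phi2_singular[OF v b] by (simp add: mu_Suc_eq[OF b] del: mu.simps)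
qed

text \<open>
  A vertical edge preserves the norm; a diagonal edge from weight \<open>k\<close> multiplies it by
  \<open>v [k] [k + 1]\<close>. The endpoint of a diagonal edge is a partition, so \<open>1 \<le> k\<close>, and it has at most
  \<open>n\<close> boxes, so \<open>k + 1 \<le> n\<close>.
\<close>
lemma mu_non_isotropic:
  assumes v: "v \<noteq> 0" and q: "qfact v n \<noteq> 0" and p: "p \<in> walks n"
  shows "m \<le> n \<Longrightarrow> form m (mu v m p) (mu v m p) \<noteq> 0"
proof (induction m)
  case 0
  then show ?case by (simp add: form_def tone_def)
next
  case (Suc m)
  then have nz: "form m (mu v m p) (mu v m p) \<noteq> 0" by simp
  have b: "singular_of_weight v m (shape_weight (p ! m)) (mu v m p)"
    using mu_singular_of_weight[OF v p] Suc.prems by simp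
  show ?case
  proof (cases "vertical (p ! m) (p ! Suc m)")
    case True
    then show ?thesis using nz by (simp add: mu_Suc_eq[OF b] form_Phi1_Phi1 del: mu.simps)
  next
    case False
    with walk_step[OF p, of m] Suc.prems have d: "diagonal (p ! m) (p ! Suc m)" by simp
    define k where "k = fst (p ! m) - snd (p ! m)"
    have k: "shape_weight (p ! m) = int k" "1 \<le> k" "Suc k \<le> n"
      using walk_vertex[OF p, of m] walk_vertex[OF p, of "Suc m"] d Suc.prems
      by (auto simp: k_def shape_weight_def diagonal_def)
    have "qint v (int k) \<noteq> 0" "qint v (int k + 1) \<noteq> 0"
      using qint_nonzero[OF q, of k] qint_nonzero[OF q, of "Suc k"] k by (simp_all add: add.commute)
    then show ?thesis
      using False nz v b k(1)
      by (simp add: mu_Suc_eq[OF b] form_Phi2_Phi2[OF v b[unfolded k(1)]] singular_of_weight_def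
          del: mu.simps)
  qed
qed

text \<open>
  If the last edges have different directions, the form vanishes by itself. If they have the same
  direction, a difference between the walks must occur before the last vertex, and the form is a
  multiple of the one for the shortened walks.
\<close>
lemma mu_orthogonal:
  assumes v: "v \<noteq> 0" and p: "p \<in> walks n" and q: "q \<in> walks n"
  shows "m \<le> n \<Longrightarrow> j \<le> m \<Longrightarrow> p ! j \<noteq> q ! j \<Longrightarrow> form m (mu v m p) (mu v m q) = 0"
proof (induction m arbitrary: j)
  case 0
  then show ?case using p q by (simp add: walks_def)
next
  case (Suc m)
  have b: "singular_of_weight v m (shape_weight (p ! m)) (mu v m p)"
    and c: "singular_of_weight v m (shape_weight (q ! m)) (mu v m q)"
    using mu_singular_of_weight[OF v p] mu_singular_of_weight[OF v q] Suc.prems(1) by simp_all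
  then have bt: "mu v m p \<in> tensor_power m" and ct: "mu v m q \<in> tensor_power m"
    by (simp_all add: singular_of_weight_def)
  note steps = walk_step[OF p, of m] walk_step[OF q, of m]
  let ?vp = "vertical (p ! m) (p ! Suc m)" and ?vq = "vertical (q ! m) (q ! Suc m)"
  show ?case
  proof (cases "?vp = ?vq")
    case True
    have "\<exists>j\<le>m. p ! j \<noteq> q ! j"
    proof (rule ccontr)
      assume "\<not> ?thesis"
      then have eq: "p ! i = q ! i" if "i \<le> m" for i using that by blast
      have "p ! Suc m = q ! Suc m"
        using True steps Suc.prems(1) eq[of m] by (auto simp: vertical_def diagonal_def)
      with eq Suc.prems(2,3) show False by (auto simp: le_Suc_eq)
    qed
    then have "form m (mu v m p) (mu v m q) = 0" using Suc.IH Suc.prems(1) by auto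
    then show ?thesis
      using True by (simp add: mu_Suc_eq[OF b] mu_Suc_eq[OF c] form_Phi1_Phi1
          form_Phi2_Phi2[OF v b ct] del: mu.simps)
  next
    case False
    then show ?thesis
      using form_Phi1_Phi2[OF v b ct] form_Phi1_Phi2[OF v c bt, THEN trans[OF form_commute]]
      by (cases ?vp) (simp_all add: mu_Suc_eq[OF b] mu_Suc_eq[OF c] del: mu.simps)
  qed
qed

lemma independent_if_orthogonal:
  fixes B :: "'a::field tvec set"
  assumes nz: "\<And>x. x \<in> B \<Longrightarrow> form n x x \<noteq> 0"
    and orth: "\<And>x y. x \<in> B \<Longrightarrow> y \<in> B \<Longrightarrow> x \<noteq> y \<Longrightarrow> form n x y = 0"
  shows "\<not> module.dependent tscale B"
proof -
  interpret vector_space "tscale :: 'a \<Rightarrow> 'a tvec \<Rightarrow> 'a tvec" by (rule vector_space_tscale)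
  show ?thesis
    unfolding independent_explicit_module
  proof (intro allI impI)
    fix T :: "'a tvec set" and u x
    assume T: "finite T" "T \<subseteq> B" and sum0: "(\<Sum>y\<in>T. tscale (u y) y) = 0" and x: "x \<in> T"
    have "0 = (\<Sum>y\<in>T. u y * form n y x)"
      using arg_cong[OF sum0, of "\<lambda>z. form n z x"] by (simp add: form_sum)
    also have "\<dots> = (\<Sum>y\<in>T. if y = x then u x * form n x x else 0)"
      by (rule sum.cong[OF refl]) (use T x orth in auto)
    also have "\<dots> = u x * form n x x" using T x by simp
    finally show "u x = 0" using nz T x by auto
  qed
qed

theorem lemma3p9:
  fixes v :: "'a::field" and n :: nat
  assumes "v \<noteq> 0" and "qfact v n \<noteq> 0"
  shows "(\<forall>p\<in>walks n. maximal v n (mu v n p)) \<and>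
         (\<forall>p\<in>walks n. non_isotropic n (mu v n p)) \<and>
         (\<forall>p\<in>walks n. \<forall>q\<in>walks n. p \<noteq> q \<longrightarrow> form n (mu v n p) (mu v n q) = 0) \<and>
         inj_on (mu v n) (walks n) \<and> \<not> module.dependent tscale (mu v n ` walks n)"
proof -
  have nz: "form n (mu v n p) (mu v n p) \<noteq> 0" if "p \<in> walks n" for p
    using mu_non_isotropic[OF assms that] by simp
  have orth: "form n (mu v n p) (mu v n q) = 0"
    if p: "p \<in> walks n" and q: "q \<in> walks n" and "p \<noteq> q" for p q
  proof -
    have len: "length p = Suc n" "length q = Suc n" using p q by (simp_all add: walks_def)
    with \<open>p \<noteq> q\<close> obtain j where "j \<le> n" "p ! j \<noteq> q ! j"
      by (metis less_Suc_eq_le nth_equalityI)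
    then show ?thesis using mu_orthogonal[OF assms(1) p q] by blast
  qed
  have "maximal v n (mu v n p)" if "p \<in> walks n" for p
    using mu_singular_of_weight[OF assms(1) that, of n] nz[OF that]
    by (auto simp: maximal_def singular_of_weight_def)
  moreover have "inj_on (mu v n) (walks n)"
  proof (rule inj_onI, rule ccontr)
    fix p q assume "p \<in> walks n" "q \<in> walks n" "mu v n p = mu v n q" "p \<noteq> q"
    then show False using nz orth by metis
  qed
  moreover have "\<not> module.dependent tscale (mu v n ` walks n)"
    by (rule independent_if_orthogonal[where n = n]) (use nz orth in auto)
  ultimately show ?thesis using nz orth by (simp add: non_isotropic_def)
qed

end
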